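(* Let $s(n)$ be the number of tournament sequences of length $n$. Then $$\log_2 s(n)=\binom{n}{2}-\log_2(n!)+O\big((\log n)^2\big)$$ as $n\to\infty$.
   Context: A tournament sequence of length $n$ is a sequence of positive integers $(t_1,\ldots,t_n)$ with $t_1=1$ and $t_i<t_{i+1}\leq 2t_i$ for $1\leq i<n$. *)

theory Defs
  imports Complex_Main "HOL-Library.Landau_Symbols"
begin

text \<open>Lists are indexed from 0, so the term \<open>t\<^sub>i\<close> of a sequence is \<open>t ! (i - 1)\<close>.\<close>

definition tournament_seqs :: "nat \<Rightarrow> nat list set" where
  "tournament_seqs n = {t. length t = n \<and> (\<forall>i<n. 0 < t ! i) \<and> (0 < n \<longrightarrow> t ! 0 = 1) \<and>
     (\<forall>i. Suc i < n \<longrightarrow> t ! i < t ! Suc i \<and> t ! Suc i \<le> 2 * t ! i)}"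

definition num_tournament_seqs :: "nat \<Rightarrow> nat" where
  "num_tournament_seqs n = card (tournament_seqs n)"

lemma tournament_seqs_nth_le:
  assumes "t \<in> tournament_seqs n" "i < n"
  shows "t ! i \<le> 2 ^ i"
  using assms(2)
proof (induction i)
  case 0
  then show ?case using assms(1) by (simp add: tournament_seqs_def)
next
  case (Suc i)
  then have "t ! Suc i \<le> 2 * t ! i" "t ! i \<le> 2 ^ i"
    using assms(1) by (auto simp: tournament_seqs_def)
  then show ?case by simp
qed

lemma finite_tournament_seqs: "finite (tournament_seqs n)"
proof (rule finite_subset)
  show "tournament_seqs n \<subseteq> {t. set t \<subseteq> {..2 ^ n} \<and> length t = n}"
  proof (intro subsetI CollectI conjI)
    fix t x assume t: "t \<in> tournament_seqs n" and "x \<in> set t"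
    then obtain i where i: "i < n" "x = t ! i"
      by (auto simp: tournament_seqs_def in_set_conv_nth)
    have "x \<le> 2 ^ i" using tournament_seqs_nth_le[OF t i(1)] i(2) by simp
    also have "\<dots> \<le> 2 ^ n" using i(1) by (simp add: power_increasing)
    finally show "x \<in> {..2 ^ n}" by simp
  qed (simp add: tournament_seqs_def)
  show "finite {t. set t \<subseteq> {..2 ^ n :: nat} \<and> length t = n}"
    by (rule finite_lists_length_eq) simp
qed

end

theory Submission
  imports Defs
begin

text \<open>
  Let \<open>S k a\<close> be the number of ways to continue a tournament sequence by \<open>k\<close> terms after a term
  \<open>a\<close>; then \<open>S (k + 1) a\<close> is the sum of \<open>S k b\<close> over \<open>a < b \<le> 2 a\<close>. Comparing the power sums with
  \<open>x ^ (k + 1) / (k + 1)\<close> at the end points gives, by induction,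
  \<open>a ^ k * (\<Prod>j=1..k. (2 ^ j - 1) / j) \<le> S k a \<le> (a + 1) ^ k * 2 ^ (k (k + 1) / 2) / k!\<close>.
  At \<open>a = 1\<close> the lower bound is sharp enough, as the product of all \<open>1 - 2 ^ (- j)\<close> is positive,
  but the upper bound loses a factor \<open>2 ^ k\<close>. This loss disappears when the first
  \<open>j \<approx> log 2 n\<close> steps are estimated trivially (at most \<open>2 ^ i\<close> choices at step \<open>i\<close>) and the
  upper bound is used from \<open>a = 2 ^ j \<ge> n\<close> on. The price is a factor \<open>n! / (n - j)! \<le> n ^ j\<close>,
  which accounts for the error term.
\<close>

section \<open>Tournament sequences as continuations of the term 1\<close>

fun continuations :: "nat \<Rightarrow> nat \<Rightarrow> nat list set" where
  "continuations 0 a = {[]}"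
| "continuations (Suc k) a = (\<Union>b\<in>{a<..2 * a}. (#) b ` continuations k b)"

fun num_continuations :: "nat \<Rightarrow> nat \<Rightarrow> nat" where
  "num_continuations 0 a = 1"
| "num_continuations (Suc k) a = (\<Sum>b\<in>{a<..2 * a}. num_continuations k b)"

lemma finite_continuations: "finite (continuations k a)"
  by (induction k arbitrary: a) auto

lemma card_continuations: "card (continuations k a) = num_continuations k a"
proof (induction k arbitrary: a)
  case (Suc k)
  have "card (continuations (Suc k) a) = (\<Sum>b\<in>{a<..2 * a}. card ((#) b ` continuations k b))"
    unfolding continuations.simps
    by (rule card_UN_disjoint) (auto simp: finite_continuations)
  also have "\<dots> = (\<Sum>b\<in>{a<..2 * a}. num_continuations k b)"
    by (intro sum.cong refl) (simp add: card_image Suc)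
  finally show ?case by simp
qed simp

text \<open>Prepending \<open>a\<close> makes \<open>(a # t) ! i\<close> the predecessor of
  \<open>t ! i\<close>, so the step from \<open>a\<close> to the first entry has the same form as
  all the others.\<close>

lemma in_continuations_iff:
  "t \<in> continuations k a \<longleftrightarrow>
     length t = k \<and> (\<forall>i<k. (a # t) ! i < t ! i \<and> t ! i \<le> 2 * (a # t) ! i)"
proof (induction k arbitrary: t a)
  case (Suc k)
  show ?case
  proof (cases t)
    case (Cons b u)
    have "t \<in> continuations (Suc k) a \<longleftrightarrow> b \<in> {a<..2 * a} \<and> u \<in> continuations k b"
      by (auto simp: Cons)
    then show ?thesis by (auto simp: Cons Suc All_less_Suc2)
  qed auto
qed auto

lemma tournament_seqs_Suc: "tournament_seqs (Suc n) = (#) 1 ` continuations n 1"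
proof (intro set_eqI)
  fix t :: "nat list"
  show "t \<in> tournament_seqs (Suc n) \<longleftrightarrow> t \<in> (#) 1 ` continuations n 1"
  proof (cases t)
    case (Cons a u)
    \<comment> \<open>Each later entry exceeds a natural number, so strict increase already yields
      positivity.\<close>
    have "\<forall>i<n. 0 < u ! i" if "\<forall>i<n. (1 # u) ! i < u ! i"
      using that by (metis less_zeroE not_gr_zero)
    then show ?thesis
      by (auto simp: Cons tournament_seqs_def in_continuations_iff All_less_Suc2 image_iff)
  qed (auto simp: tournament_seqs_def)
qed

lemma num_tournament_seqs_Suc: "num_tournament_seqs (Suc n) = num_continuations n 1"
  by (simp add: num_tournament_seqs_def tournament_seqs_Suc card_image card_continuations)

section \<open>Bounds for continuations by telescoping powers\<close>

lemma power_diff_bounds: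
  fixes x y :: real
  assumes "0 \<le> x" "x \<le> y"
  shows "real (Suc k) * x ^ k * (y - x) \<le> y ^ Suc k - x ^ Suc k"
    and "y ^ Suc k - x ^ Suc k \<le> real (Suc k) * y ^ k * (y - x)"
proof -
  \<comment> \<open>The difference of powers is \<open>y - x\<close> times \<open>k + 1\<close>
    summands \<open>y ^ i * x ^ (k - i)\<close>, each between \<open>x ^ k\<close> and
    \<open>y ^ k\<close>.\<close>
  have *: "x ^ k \<le> y ^ i * x ^ (k - i)" "y ^ i * x ^ (k - i) \<le> y ^ k" if "i \<le> k" for i
  proof -
    have k: "z ^ k = z ^ i * z ^ (k - i)" for z :: real
      using that by (simp flip: power_add)
    show "x ^ k \<le> y ^ i * x ^ (k - i)" "y ^ i * x ^ (k - i) \<le> y ^ k"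
      unfolding k[of x] k[of y]
      using assms by (auto intro!: mult_right_mono mult_left_mono power_mono)
  qed
  have eq: "y ^ Suc k - x ^ Suc k = (y - x) * (\<Sum>i<Suc k. y ^ i * x ^ (k - i))"
    by (subst diff_power_eq_sum) simp
  have "(\<Sum>i<Suc k. x ^ k) \<le> (\<Sum>i<Suc k. y ^ i * x ^ (k - i))"
    by (rule sum_mono) (simp add: *)
  from mult_left_mono[OF this, of "y - x"] assms
  show "real (Suc k) * x ^ k * (y - x) \<le> y ^ Suc k - x ^ Suc k"
    unfolding eq by (simp add: mult_ac)
  have "(\<Sum>i<Suc k. y ^ i * x ^ (k - i)) \<le> (\<Sum>i<Suc k. y ^ k)"
    by (rule sum_mono) (simp add: *)
  from mult_left_mono[OF this, of "y - x"] assms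
  show "y ^ Suc k - x ^ Suc k \<le> real (Suc k) * y ^ k * (y - x)"
    unfolding eq by (simp add: mult_ac)
qed

lemma sum_greaterThanAtMost_telescope:
  fixes f :: "nat \<Rightarrow> real"
  assumes "m \<le> n"
  shows "(\<Sum>b\<in>{m<..n}. f b - f (b - 1)) = f n - f m"
  using assms
proof (induction n rule: dec_induct)
  case (step n)
  then have "{m<..Suc n} = insert (Suc n) {m<..n}" by auto
  with step show ?case by simp
qed simp

text \<open>The power of 2 times the product equals the product of \<open>2 ^ i - 1\<close> for i =
  1, ..., k: each induction step contributes \<open>(2 * a) ^ Suc k - a ^ Suc k\<close>, that is, a
  factor \<open>2 ^ Suc k - 1\<close>.\<close>

lemma num_continuations_ge:
  "real a ^ k * 2 ^ (Suc k choose 2) / fact k * (\<Prod>j<k. 1 - 1 / 2 ^ Suc j)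
     \<le> real (num_continuations k a)"
proof (induction k arbitrary: a)
  case (Suc k)
  define c :: real where "c = 2 ^ (Suc k choose 2) / fact k * (\<Prod>j<k. 1 - 1 / 2 ^ Suc j)"
  have "c \<ge> 0" unfolding c_def
    by (intro mult_nonneg_nonneg prod_nonneg) (auto simp: one_le_power simp flip: power_Suc)
  have choose: "Suc (Suc k) choose 2 = Suc k + (Suc k choose 2)"
    by (simp add: numeral_2_eq_2)
  have "real a ^ Suc k * 2 ^ (Suc (Suc k) choose 2) / fact (Suc k) * (\<Prod>j<Suc k. 1 - 1 / 2 ^ Suc j)
      = c / Suc k * (real (2 * a) ^ Suc k - real a ^ Suc k)"
  proof -
    have "real (2 * a) ^ Suc k - real a ^ Suc k = real a ^ Suc k * 2 ^ Suc k * (1 - 1 / 2 ^ Suc k)"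
      by (simp add: power_mult_distrib right_diff_distrib del: power_Suc)
    then show ?thesis
      unfolding choose power_add by (simp add: c_def mult_ac del: power_Suc)
  qed
  also have "real (2 * a) ^ Suc k - real a ^ Suc k
      = (\<Sum>b\<in>{a<..2 * a}. real b ^ Suc k - real (b - 1) ^ Suc k)"
    by (subst sum_greaterThanAtMost_telescope[where f = "\<lambda>b. real b ^ Suc k"]) auto
  also have "c / Suc k * \<dots> \<le> c / Suc k * (\<Sum>b\<in>{a<..2 * a}. Suc k * real b ^ k)"
  proof (intro mult_left_mono sum_mono)
    fix b assume "b \<in> {a<..2 * a}"
    \<comment> \<open>Here \<open>b > a\<close> makes \<open>b\<close> positive, so the truncated
      subtraction is exact.\<close>
    then have "real b - real (b - 1) = 1" by (auto simp: of_nat_diff)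
    then show "real b ^ Suc k - real (b - 1) ^ Suc k \<le> Suc k * real b ^ k"
      using power_diff_bounds(2)[of "real (b - 1)" "real b" k] by simp
  qed (use \<open>c \<ge> 0\<close> in auto)
  also have "\<dots> = (\<Sum>b\<in>{a<..2 * a}. c * real b ^ k)"
    by (simp add: sum_distrib_left field_simps del: of_nat_Suc)
  also have "\<dots> \<le> (\<Sum>b\<in>{a<..2 * a}. real (num_continuations k b))"
    using Suc by (intro sum_mono) (simp add: c_def mult_ac)
  finally show ?case by simp
qed (simp add: binomial_eq_0)

text \<open>The shift by 1 reproduces itself: the sum telescopes from \<open>a + 2\<close> up to
  \<open>2 * a + 2 = 2 * (a + 1)\<close>, and the subtracted power at \<open>a + 2\<close> is
  dropped.\<close>

lemma num_continuations_le:
  "real (num_continuations k a) \<le> (real a + 1) ^ k * 2 ^ (Suc k choose 2) / fact k"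
proof (induction k arbitrary: a)
  case (Suc k)
  define c :: real where "c = 2 ^ (Suc k choose 2) / fact k"
  have "c \<ge> 0" unfolding c_def by simp
  have choose: "Suc (Suc k) choose 2 = Suc k + (Suc k choose 2)"
    by (simp add: numeral_2_eq_2)
  have "real (num_continuations (Suc k) a) \<le> (\<Sum>b\<in>{a<..2 * a}. c * (real b + 1) ^ k)"
    unfolding num_continuations.simps of_nat_sum
    using Suc by (intro sum_mono) (simp add: c_def mult_ac)
  also have "\<dots> = c / Suc k * (\<Sum>b\<in>{a<..2 * a}. Suc k * (real b + 1) ^ k)"
    by (simp add: sum_distrib_left field_simps del: of_nat_Suc)
  also have "\<dots> \<le> c / Suc k *
      (\<Sum>b\<in>{a<..2 * a}. (real b + 2) ^ Suc k - (real (b - 1) + 2) ^ Suc k)"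
  proof (intro mult_left_mono sum_mono)
    fix b assume "b \<in> {a<..2 * a}"
    then have "real (b - 1) + 2 = real b + 1" by (auto simp: of_nat_diff)
    then show "Suc k * (real b + 1) ^ k \<le> (real b + 2) ^ Suc k - (real (b - 1) + 2) ^ Suc k"
      using power_diff_bounds(1)[of "real b + 1" "real b + 2" k] by (simp only:) simp
  qed (use \<open>c \<ge> 0\<close> in auto)
  also have "\<dots> = c / Suc k * ((real (2 * a) + 2) ^ Suc k - (real a + 2) ^ Suc k)"
    by (subst sum_greaterThanAtMost_telescope[where f = "\<lambda>b. (real b + 2) ^ Suc k"]) auto
  also have "\<dots> \<le> c / Suc k * (2 * (real a + 1)) ^ Suc k"
    using \<open>c \<ge> 0\<close> by (intro mult_left_mono) (auto simp: algebra_simps)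
  also have "\<dots> = (real a + 1) ^ Suc k * 2 ^ (Suc (Suc k) choose 2) / fact (Suc k)"
    unfolding choose power_mult_distrib by (simp add: c_def power_add field_simps)
  finally show ?case .
qed simp

text \<open>After i steps the term is at most \<open>2 ^ i * a\<close>, which also bounds the number
  of choices for the next one; the first \<open>j\<close> steps thus give
  \<open>a ^ j * 2 ^ (j choose 2)\<close>. The induction peels off the first step and replaces each
  \<open>b\<close> by \<open>2 * a\<close>.\<close>

lemma num_continuations_add_le:
  "real (num_continuations (j + k) a)
     \<le> real a ^ j * 2 ^ (j choose 2) * ((2 ^ j * real a + 1) ^ k * 2 ^ (Suc k choose 2) / fact k)"
proof (induction j arbitrary: a)
  case 0
  show ?case using num_continuations_le[of k a] by (simp add: binomial_eq_0)
next
  case (Suc j)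
  define B where "B = real (2 * a) ^ j * 2 ^ (j choose 2) *
    ((2 ^ j * real (2 * a) + 1) ^ k * 2 ^ (Suc k choose 2) / fact k)"
  have choose: "Suc j choose 2 = j + (j choose 2)"
    by (simp add: numeral_2_eq_2)
  have "real (num_continuations (Suc j + k) a) = (\<Sum>b\<in>{a<..2 * a}. real (num_continuations (j + k) b))"
    by simp
  also have "\<dots> \<le> (\<Sum>b\<in>{a<..2 * a}. B)"
  proof (rule sum_mono)
    fix b assume "b \<in> {a<..2 * a}"
    then have "real b ^ j * 2 ^ (j choose 2) *
        ((2 ^ j * real b + 1) ^ k * 2 ^ (Suc k choose 2) / fact k) \<le> B"
      unfolding B_def
      by (intro mult_mono mult_right_mono divide_right_mono power_mono add_mono mult_left_mono)
         auto
    with Suc[of b] show "real (num_continuations (j + k) b) \<le> B" by linarith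
  qed
  also have "\<dots> = real a * B" by simp
  also have "\<dots> = real a ^ Suc j * 2 ^ (Suc j choose 2) *
      ((2 ^ Suc j * real a + 1) ^ k * 2 ^ (Suc k choose 2) / fact k)"
    unfolding B_def choose by (simp add: power_mult_distrib power_add mult_ac)
  finally show ?case .
qed

section \<open>Bounds for the number of tournament sequences\<close>

text \<open>The summand \<open>1 / 2 ^ (N + 2)\<close> makes the induction go through.\<close>
lemma prod_one_minus_half_power_ge:
  "1 / 4 + 1 / 2 ^ (N + 2) \<le> (\<Prod>j<Suc N. 1 - 1 / 2 ^ Suc j :: real)"
proof (induction N)
  case (Suc N)
  define x :: real where "x = 1 / 2 ^ Suc N"
  have x: "0 < x" "x \<le> 1 / 2" by (auto simp: x_def one_le_power)
  \<comment> \<open>Expanding the product below gives 1/4 + 3x/8 - x^2/4, so the claim amounts to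
    x^2 <= x/2.\<close>
  have "x * x \<le> x * (1 / 2)" using x by (intro mult_left_mono) auto
  then have "1 / 4 + x / 4 \<le> (1 / 4 + x / 2) * (1 - x / 2)"
    by (simp add: algebra_simps)
  also have "\<dots> \<le> (\<Prod>j<Suc N. 1 - 1 / 2 ^ Suc j) * (1 - x / 2)"
  proof (rule mult_right_mono)
    show "1 / 4 + x / 2 \<le> (\<Prod>j<Suc N. 1 - 1 / 2 ^ Suc j)"
      using Suc by (simp add: x_def)
  qed (use x in simp)
  also have "\<dots> = (\<Prod>j<Suc (Suc N). 1 - 1 / 2 ^ Suc j)"
    by (simp add: x_def)
  finally show ?case by (simp add: x_def)
qed simp

lemma num_tournament_seqs_ge:
  assumes "n \<ge> 2"
  shows "2 ^ (n choose 2) / (4 * fact n) \<le> real (num_tournament_seqs n)"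
proof -
  obtain k where n: "n = Suc (Suc k)"
    using assms by (metis Suc_le_D numeral_2_eq_2 Suc_le_mono)
  have "(0::real) \<le> 1 / 2 ^ (k + 2)" by simp
  then have P: "(\<Prod>j<Suc k. 1 - 1 / 2 ^ Suc j :: real) \<ge> 1 / 4"
    using prod_one_minus_half_power_ge[of k] by linarith
  have "2 ^ (n choose 2) / (4 * fact n) = (2 ^ (n choose 2) / fact n * (1 / 4) :: real)"
    by simp
  \<comment> \<open>Passing between \<open>fact (Suc k)\<close> and \<open>fact n\<close> costs a
    factor \<open>n\<close>, only log n in the logarithm.\<close>
  also have "\<dots> \<le> 2 ^ (n choose 2) / fact (Suc k) * (\<Prod>j<Suc k. 1 - 1 / 2 ^ Suc j)"
    using P unfolding n
    by (intro mult_mono divide_left_mono fact_mono) auto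
  also have "\<dots> \<le> real (num_tournament_seqs n)"
    using num_continuations_ge[of 1 "Suc k"] by (simp add: n num_tournament_seqs_Suc)
  finally show ?thesis .
qed

lemma num_tournament_seqs_le:
  assumes "j < n" "n \<le> 2 ^ j"
  shows "real (num_tournament_seqs n) \<le> 4 * real n ^ Suc j * 2 ^ (n choose 2) / fact n"
proof -
  define k where "k = n - Suc j"
  have n: "n = Suc (j + k)" using assms by (simp add: k_def)
  \<comment> \<open>The last summand \<open>j\<close> is slack, given away at the end.\<close>
  have choose: "n choose 2 = j * k + (j choose 2) + (Suc k choose 2) + j"
    unfolding n by (induction j) (simp_all add: numeral_2_eq_2)
  \<comment> \<open>Since \<open>k < n\<close> and \<open>n \<le> 2 ^ j\<close>, the shift by 1
    costs at most a factor e < 4.\<close>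
  have "(2 ^ j + 1 :: real) ^ k = 2 ^ (j * k) * (1 + 1 / 2 ^ j) ^ k"
    by (simp add: power_mult field_simps flip: power_mult_distrib)
  also have "(1 + 1 / 2 ^ j :: real) ^ k \<le> exp (1 / 2 ^ j) ^ k"
    by (intro power_mono exp_ge_add_one_self) auto
  also have "\<dots> = exp (real k / 2 ^ j)"
    by (simp flip: exp_of_nat_mult)
  also have "\<dots> \<le> exp 1"
  proof -
    have "real k \<le> real (2 ^ j)" using assms n by (intro of_nat_mono) linarith
    then show ?thesis by (simp add: field_simps)
  qed
  also have "\<dots> \<le> (4 :: real)" using exp_le by linarith
  finally have A: "(2 ^ j + 1 :: real) ^ k \<le> 2 ^ (j * k) * 4" by simp
  have "(fact n :: nat) \<le> n ^ (n - k) * fact k"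
    using fact_div_fact_le_pow[of "n - k" n] fact_dvd[of k n] n
    by (metis (no_types, lifting) add_diff_cancel_right' diff_diff_cancel diff_le_self dvd_div_mult_self le_add2 le_SucI mult_le_mono1)
  moreover have "n - k = Suc j" using n by simp
  ultimately have "real (fact n) \<le> real (n ^ Suc j * fact k)"
    by (metis of_nat_mono)
  then have F: "1 / fact k \<le> real n ^ Suc j / (fact n :: real)"
    by (simp add: field_simps)
  have "real (num_tournament_seqs n)
      \<le> 2 ^ (j choose 2) * ((2 ^ j + 1) ^ k * 2 ^ (Suc k choose 2) / fact k)"
    using num_continuations_add_le[of j k 1] by (simp add: n num_tournament_seqs_Suc)
  also have "\<dots> \<le> 2 ^ (j choose 2) * (2 ^ (j * k) * 4 * 2 ^ (Suc k choose 2) / fact k)"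
    using A by (intro mult_left_mono divide_right_mono mult_right_mono) auto
  also have "\<dots> = 4 * 2 ^ (j * k + (j choose 2) + (Suc k choose 2)) * (1 / fact k)"
    by (simp add: power_add)
  also have "\<dots> \<le> 4 * 2 ^ (n choose 2) * (real n ^ Suc j / fact n)"
    using F unfolding choose
    by (intro mult_mono F mult_left_mono power_increasing) auto
  finally show ?thesis by (simp add: mult_ac)
qed

theorem theorem3:
  shows "(\<lambda>n::nat. log 2 (real (num_tournament_seqs n))
            - (real (n choose 2) - log 2 (fact n))) \<in> O(\<lambda>n. (ln (real n))\<^sup>2)"
proof (rule bigoI)
  show "eventually (\<lambda>n. norm (log 2 (real (num_tournament_seqs n))
      - (real (n choose 2) - log 2 (fact n))) \<le> 5 / (ln 2)\<^sup>2 * norm ((ln (real n))\<^sup>2)) at_top"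
    using eventually_ge_at_top[of 2]
  proof eventually_elim
    case (elim n)
    define s where "s = real (num_tournament_seqs n)"
    define L where "L = log 2 (real n)"
    have lower: "2 ^ (n choose 2) / (4 * fact n) \<le> s"
      using num_tournament_seqs_ge[OF elim] by (simp add: s_def)
    have "0 < (2 ^ (n choose 2) / (4 * fact n) :: real)" by simp
    with lower have "s > 0" by linarith
    have log4: "log 2 4 = (2 :: real)"
      using log_pow_cancel[of 2 2] by simp
    have "L \<ge> 1" using elim by (simp add: L_def)
    then have "L \<le> L\<^sup>2" "1 \<le> L\<^sup>2"
      by (auto simp: self_le_power one_le_power)
    from lower have "log 2 (2 ^ (n choose 2) / (4 * fact n)) \<le> log 2 s"
      by (subst log_le_cancel_iff) (use \<open>s > 0\<close> in auto)
    then have "real (n choose 2) - 2 - log 2 (fact n) \<le> log 2 s"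
      by (simp add: log_divide log_mult log4 log_nat_power)
    moreover have "log 2 s \<le> 5 * L\<^sup>2 + real (n choose 2) - log 2 (fact n)"
    proof -
      \<comment> \<open>The cut-off is j = i + 1, the least exponent with
        \<open>n \<le> 2 ^ j\<close>; hence j <= L + 1.\<close>
      obtain i where i: "2 ^ i < n" "n \<le> 2 ^ (i + 1)"
        using ex_power_ivl2[of 2 n] elim by auto
      have "i < 2 ^ i" by simp
      with i have "Suc i < n" by linarith
      have "real (2 ^ i) \<le> real n" using i by (intro of_nat_mono) simp
      then have "log 2 (2 ^ i) \<le> L" unfolding L_def
        by (subst log_le_cancel_iff) (use elim in auto)
      then have "real i \<le> L" by (simp add: log_nat_power)
      have "s \<le> 4 * real n ^ Suc (Suc i) * 2 ^ (n choose 2) / fact n"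
        using num_tournament_seqs_le[OF \<open>Suc i < n\<close>] i by (simp add: s_def)
      then have "log 2 s \<le> log 2 (4 * real n ^ Suc (Suc i) * 2 ^ (n choose 2) / fact n)"
        by (subst log_le_cancel_iff) (use \<open>s > 0\<close> elim in auto)
      also have "\<dots> = 2 + real (Suc (Suc i)) * L + real (n choose 2) - log 2 (fact n)"
        using elim by (simp add: log_divide log_mult log4 log_nat_power L_def del: power_Suc)
      also have "real (Suc (Suc i)) * L \<le> (L + 2) * L"
        using \<open>real i \<le> L\<close> \<open>L \<ge> 1\<close> by (intro mult_right_mono) auto
      finally have "log 2 s \<le> 2 + (L\<^sup>2 + 2 * L) + real (n choose 2) - log 2 (fact n)"
        by (simp add: power2_eq_square algebra_simps)
      \<comment> \<open>The constant is 5 = 2 + 1 + 2, bounding both 1 and \<open>L\<close> by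
        \<open>L\<^sup>2\<close>.\<close>
      with \<open>L \<le> L\<^sup>2\<close> \<open>1 \<le> L\<^sup>2\<close> show ?thesis by linarith
    qed
    ultimately have "\<bar>log 2 s - (real (n choose 2) - log 2 (fact n))\<bar> \<le> 5 * L\<^sup>2"
      using \<open>1 \<le> L\<^sup>2\<close> by linarith
    also have "\<dots> = 5 / (ln 2)\<^sup>2 * (ln (real n))\<^sup>2"
      by (simp add: L_def log_def power_divide)
    finally show ?case by (simp add: s_def)
  qed
qed

end
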